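(* No Boolean algebra is canonical for LTP. That is, there is no Boolean algebra $B$ such that for all sets of LTP-formulas $\Delta$ and all LTP-formulas $\psi$: $\Delta\vDash\psi$ iff $\Delta\vDash_{B}\psi$.
   Context: Boolean algebras $B$ are written with operations $0,1,-,+,\cdot$ (bottom, top, complement, join, meet); the one-element Boolean algebra is allowed. The powerset $\mathcal{P}(B)$ carries external operations $\bot=\emptyset$, $\neg X=B\setminus X$, $X\vee Y=X\cup Y$, $X\wedge Y=X\cap Y$, and internal operations $\dot\bot=\{0\}$, $\dot\neg X=\{-a\mid a\in X\}$, $X\mathbin{\dot\vee}Y=\{a+b\mid a\in X,b\in Y\}$, $X\mathbin{\dot\wedge}Y=\{a\cdot b\mid a\in X,b\in Y\}$. The formulas of LTP form the absolutely free algebra $\mathrm{Fm}$ generated by propositional variables $P_0,P_1,\dots$ using constants $\bot,\dot\bot$, unary $\neg,\dot\neg$, and binary $\vee,\wedge,\dot\vee,\dot\wedge$. Homomorphisms $H:\mathrm{Fm}\to\mathcal{P}(B)$ preserve all eight operations. $\Delta\vDash_B\psi$ iff for all homomorphisms $H:\mathrm{Fm}\to\mathcal{P}(B)$, $\bigcap_{\phi\in\Delta}H(\phi)\subseteq H(\psi)$ (the empty intersection being $B$). $\Delta\vDash\psi$ iff $\Delta\vDash_B\psi$ for all Boolean algebras $B$. *)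

theory Defs
  imports Main "HOL-Library.Countable_Set" "HOL-Library.Infinite_Typeclass"
begin

section \<open>Boolean algebras on a carrier set\<close>

record 'a balg =
  ba_carrier :: "'a set"
  ba_zero :: 'a
  ba_one :: 'a
  ba_compl :: "'a \<Rightarrow> 'a"
  ba_join :: "'a \<Rightarrow> 'a \<Rightarrow> 'a"
  ba_meet :: "'a \<Rightarrow> 'a \<Rightarrow> 'a"

text \<open>The axioms are those of the library locale
  \<open>abstract_boolean_algebra\<close>, relativised to a carrier set. A carrier is needed because the
  consequence relation ranges over Boolean algebras of all cardinalities. The case
  \<open>ba_zero B = ba_one B\<close> (one-element algebra) is allowed.\<close>

locale boolalg =
  fixes B :: "'a balg"
  assumes zero_closed: "ba_zero B \<in> ba_carrier B"
    and one_closed: "ba_one B \<in> ba_carrier B"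
    and compl_closed: "x \<in> ba_carrier B \<Longrightarrow> ba_compl B x \<in> ba_carrier B"
    and join_closed:
      "x \<in> ba_carrier B \<Longrightarrow> y \<in> ba_carrier B \<Longrightarrow> ba_join B x y \<in> ba_carrier B"
    and meet_closed:
      "x \<in> ba_carrier B \<Longrightarrow> y \<in> ba_carrier B \<Longrightarrow> ba_meet B x y \<in> ba_carrier B"
    and join_assoc:
      "x \<in> ba_carrier B \<Longrightarrow> y \<in> ba_carrier B \<Longrightarrow> z \<in> ba_carrier B \<Longrightarrow>
        ba_join B (ba_join B x y) z = ba_join B x (ba_join B y z)"
    and meet_assoc:
      "x \<in> ba_carrier B \<Longrightarrow> y \<in> ba_carrier B \<Longrightarrow> z \<in> ba_carrier B \<Longrightarrow>
        ba_meet B (ba_meet B x y) z = ba_meet B x (ba_meet B y z)"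
    and join_commute:
      "x \<in> ba_carrier B \<Longrightarrow> y \<in> ba_carrier B \<Longrightarrow> ba_join B x y = ba_join B y x"
    and meet_commute:
      "x \<in> ba_carrier B \<Longrightarrow> y \<in> ba_carrier B \<Longrightarrow> ba_meet B x y = ba_meet B y x"
    and meet_join_distrib:
      "x \<in> ba_carrier B \<Longrightarrow> y \<in> ba_carrier B \<Longrightarrow> z \<in> ba_carrier B \<Longrightarrow>
        ba_meet B x (ba_join B y z) = ba_join B (ba_meet B x y) (ba_meet B x z)"
    and join_meet_distrib:
      "x \<in> ba_carrier B \<Longrightarrow> y \<in> ba_carrier B \<Longrightarrow> z \<in> ba_carrier B \<Longrightarrow>
        ba_join B x (ba_meet B y z) = ba_meet B (ba_join B x y) (ba_join B x z)"
    and meet_one: "x \<in> ba_carrier B \<Longrightarrow> ba_meet B x (ba_one B) = x"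
    and join_zero: "x \<in> ba_carrier B \<Longrightarrow> ba_join B x (ba_zero B) = x"
    and meet_compl: "x \<in> ba_carrier B \<Longrightarrow> ba_meet B x (ba_compl B x) = ba_zero B"
    and join_compl: "x \<in> ba_carrier B \<Longrightarrow> ba_join B x (ba_compl B x) = ba_one B"

lemma boolalg_type_class:
  "boolalg \<lparr>ba_carrier = (UNIV :: 'a::boolean_algebra set), ba_zero = bot, ba_one = top,
     ba_compl = uminus, ba_join = sup, ba_meet = inf\<rparr>"
  by unfold_locales
    (simp_all, (rule sup_assoc inf_assoc sup_commute inf_commute inf_sup_distrib1 sup_inf_distrib1)+)


section \<open>Formulas and homomorphisms\<close>

datatype ltp =
    Var nat
  | Bot
  | IBot
  | Neg ltp
  | INeg ltp
  | Or ltp ltp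
  | And ltp ltp
  | IOr ltp ltp
  | IAnd ltp ltp

instance ltp :: countable
  by countable_datatype

text \<open>The constructors with prefix \<open>I\<close> are the internal (dotted) connectives, interpreted
  pointwise; the others are interpreted by the set operations of the powerset.\<close>

definition ineg :: "'a balg \<Rightarrow> 'a set \<Rightarrow> 'a set" where
  "ineg B X = {ba_compl B a | a. a \<in> X}"

definition ior :: "'a balg \<Rightarrow> 'a set \<Rightarrow> 'a set \<Rightarrow> 'a set" where
  "ior B X Y = {ba_join B a b | a b. a \<in> X \<and> b \<in> Y}"

definition iand :: "'a balg \<Rightarrow> 'a set \<Rightarrow> 'a set \<Rightarrow> 'a set" where
  "iand B X Y = {ba_meet B a b | a b. a \<in> X \<and> b \<in> Y}"

definition ltp_hom :: "'a balg \<Rightarrow> (ltp \<Rightarrow> 'a set) \<Rightarrow> bool" where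
  "ltp_hom B H \<longleftrightarrow>
     (\<forall>\<phi>. H \<phi> \<in> Pow (ba_carrier B)) \<and>
     H Bot = {} \<and>
     H IBot = {ba_zero B} \<and>
     (\<forall>\<phi>. H (Neg \<phi>) = ba_carrier B - H \<phi>) \<and>
     (\<forall>\<phi>. H (INeg \<phi>) = ineg B (H \<phi>)) \<and>
     (\<forall>\<phi> \<chi>. H (Or \<phi> \<chi>) = H \<phi> \<union> H \<chi>) \<and>
     (\<forall>\<phi> \<chi>. H (And \<phi> \<chi>) = H \<phi> \<inter> H \<chi>) \<and>
     (\<forall>\<phi> \<chi>. H (IOr \<phi> \<chi>) = ior B (H \<phi>) (H \<chi>)) \<and>
     (\<forall>\<phi> \<chi>. H (IAnd \<phi> \<chi>) = iand B (H \<phi>) (H \<chi>))"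


section \<open>Consequence\<close>

definition ltp_entails_in :: "'a balg \<Rightarrow> ltp set \<Rightarrow> ltp \<Rightarrow> bool" where
  "ltp_entails_in B \<Delta> \<psi> \<longleftrightarrow>
     (\<forall>H. ltp_hom B H \<longrightarrow> ba_carrier B \<inter> (\<Inter>\<phi>\<in>\<Delta>. H \<phi>) \<subseteq> H \<psi>)"

text \<open>HOL cannot quantify over all types inside a formula, so consequence over all Boolean
  algebras is taken over all Boolean algebras whose carrier is a subset of some infinite type
  \<open>'u\<close>. The choice of \<open>'u\<close> is immaterial: by the theorem \<open>ltp_entails_imp_entails_in\<close> below,
  the relation so obtained already implies consequence in every Boolean algebra on
  \<^emph>\<open>every\<close> type.\<close>

definition ltp_entails :: "'u::infinite itself \<Rightarrow> ltp set \<Rightarrow> ltp \<Rightarrow> bool" where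
  "ltp_entails U \<Delta> \<psi> \<longleftrightarrow> (\<forall>B :: 'u balg. boolalg B \<longrightarrow> ltp_entails_in B \<Delta> \<psi>)"


section \<open>Independence of the universe\<close>

text \<open>A Loewenheim-Skolem argument: a counterexample in any Boolean algebra restricts to a
  countable subalgebra containing witnesses for the internal binary connectives.\<close>

lemma countable_witness_subalgebra:
  fixes B :: "'b balg"
  assumes B: "boolalg B" and H: "ltp_hom B H" and a: "a \<in> ba_carrier B"
  obtains S where "countable S" "S \<subseteq> ba_carrier B" "a \<in> S" "ba_zero B \<in> S" "ba_one B \<in> S"
    "\<And>x. x \<in> S \<Longrightarrow> ba_compl B x \<in> S"
    "\<And>x y. x \<in> S \<Longrightarrow> y \<in> S \<Longrightarrow> ba_join B x y \<in> S"
    "\<And>x y. x \<in> S \<Longrightarrow> y \<in> S \<Longrightarrow> ba_meet B x y \<in> S"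
    "\<And>x \<phi> \<chi>. x \<in> S \<Longrightarrow> x \<in> H (IOr \<phi> \<chi>) \<Longrightarrow>
       \<exists>y\<in>S \<inter> H \<phi>. \<exists>z\<in>S \<inter> H \<chi>. x = ba_join B y z"
    "\<And>x \<phi> \<chi>. x \<in> S \<Longrightarrow> x \<in> H (IAnd \<phi> \<chi>) \<Longrightarrow>
       \<exists>y\<in>S \<inter> H \<phi>. \<exists>z\<in>S \<inter> H \<chi>. x = ba_meet B y z"
proof -
  interpret boolalg B by (rule B)
  let ?C = "ba_carrier B"
  have HC: "H \<phi> \<subseteq> ?C" for \<phi> using H by (auto simp: ltp_hom_def)
  have "\<forall>x \<phi> \<chi>. \<exists>y z. x \<in> H (IOr \<phi> \<chi>) \<longrightarrow> y \<in> H \<phi> \<and> z \<in> H \<chi> \<and> x = ba_join B y z"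
    using H by (auto simp: ltp_hom_def ior_def)
  then obtain p q where pq: "\<And>x \<phi> \<chi>. x \<in> H (IOr \<phi> \<chi>) \<Longrightarrow>
      p x \<phi> \<chi> \<in> H \<phi> \<and> q x \<phi> \<chi> \<in> H \<chi> \<and> x = ba_join B (p x \<phi> \<chi>) (q x \<phi> \<chi>)"
    by metis
  have "\<forall>x \<phi> \<chi>. \<exists>y z. x \<in> H (IAnd \<phi> \<chi>) \<longrightarrow> y \<in> H \<phi> \<and> z \<in> H \<chi> \<and> x = ba_meet B y z"
    using H by (auto simp: ltp_hom_def iand_def)
  then obtain r s where rs: "\<And>x \<phi> \<chi>. x \<in> H (IAnd \<phi> \<chi>) \<Longrightarrow>
      r x \<phi> \<chi> \<in> H \<phi> \<and> s x \<phi> \<chi> \<in> H \<chi> \<and> x = ba_meet B (r x \<phi> \<chi>) (s x \<phi> \<chi>)"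
    by metis
  define F where "F X = X \<union> ba_compl B ` X
      \<union> (\<Union>x\<in>X. \<Union>y\<in>X. {ba_join B x y, ba_meet B x y})
      \<union> (\<Union>x\<in>X. \<Union>\<phi>. \<Union>\<chi>. {p x \<phi> \<chi>, q x \<phi> \<chi>, r x \<phi> \<chi>, s x \<phi> \<chi>} \<inter> ?C)" for X
  define T where "T n = (F ^^ n) {a, ba_zero B, ba_one B}" for n
  have T_Suc: "T (Suc n) = F (T n)" for n by (simp add: T_def)
  have cT: "countable (T n)" for n
  proof (induction n)
    case 0 show ?case by (simp add: T_def)
  next
    case (Suc n) then show ?case unfolding T_Suc F_def
      by (intro countable_Un countable_UN countable_image countable_Int1) auto
  qed
  have TC: "T n \<subseteq> ?C" for n
  proof (induction n)
    case 0 show ?case using a by (simp add: T_def zero_closed one_closed)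
  next
    case (Suc n) then show ?case unfolding T_Suc F_def
      by (auto intro!: compl_closed join_closed meet_closed)
  qed
  have mono: "T m \<subseteq> T n" if "m \<le> n" for m n
    using that by (rule lift_Suc_mono_le[rotated]) (auto simp: T_Suc F_def)
  define S where "S = (\<Union>n. T n)"
  have two: "\<exists>n. x \<in> T n \<and> y \<in> T n" if "x \<in> S" "y \<in> S" for x y
  proof -
    from that obtain i j where "x \<in> T i" "y \<in> T j" by (auto simp: S_def)
    then show ?thesis using mono[of i "max i j"] mono[of j "max i j"] by auto
  qed
  have step: "F (T n) \<subseteq> S" for n
    unfolding S_def T_Suc[symmetric] by blast
  show ?thesis
  proof (rule that[of S])
    show "countable S" unfolding S_def using cT by auto
    show "S \<subseteq> ?C" unfolding S_def using TC by auto
    have "T 0 \<subseteq> S" unfolding S_def by blast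
    then show "a \<in> S" "ba_zero B \<in> S" "ba_one B \<in> S" by (auto simp: T_def)
    show "ba_compl B x \<in> S" if x: "x \<in> S" for x
    proof -
      obtain n where "x \<in> T n" using x by (auto simp: S_def)
      then have "ba_compl B x \<in> F (T n)" by (auto simp: F_def)
      then show ?thesis using step by blast
    qed
    show "ba_join B x y \<in> S" "ba_meet B x y \<in> S" if xy: "x \<in> S" "y \<in> S" for x y
    proof -
      obtain n where "x \<in> T n" "y \<in> T n" using two[OF xy] by blast
      then have "ba_join B x y \<in> F (T n)" "ba_meet B x y \<in> F (T n)" by (auto simp: F_def)
      then show "ba_join B x y \<in> S" "ba_meet B x y \<in> S" using step by blast+
    qed
    show "\<exists>y\<in>S \<inter> H \<phi>. \<exists>z\<in>S \<inter> H \<chi>. x = ba_join B y z"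
      if x: "x \<in> S" "x \<in> H (IOr \<phi> \<chi>)" for x \<phi> \<chi>
    proof -
      obtain n where n: "x \<in> T n" using x by (auto simp: S_def)
      have "p x \<phi> \<chi> \<in> ?C" "q x \<phi> \<chi> \<in> ?C" using pq[OF x(2)] HC by blast+
      then have "{p x \<phi> \<chi>, q x \<phi> \<chi>} \<subseteq> F (T n)"
        using n unfolding F_def by (intro le_supI2) auto
      then show ?thesis using pq[OF x(2)] step by blast
    qed
    show "\<exists>y\<in>S \<inter> H \<phi>. \<exists>z\<in>S \<inter> H \<chi>. x = ba_meet B y z"
      if x: "x \<in> S" "x \<in> H (IAnd \<phi> \<chi>)" for x \<phi> \<chi>
    proof -
      obtain n where n: "x \<in> T n" using x by (auto simp: S_def)
      have "r x \<phi> \<chi> \<in> ?C" "s x \<phi> \<chi> \<in> ?C" using rs[OF x(2)] HC by blast+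
      then have "{r x \<phi> \<chi>, s x \<phi> \<chi>} \<subseteq> F (T n)"
        using n unfolding F_def by (intro le_supI2) auto
      then show ?thesis using rs[OF x(2)] step by blast
    qed
  qed
qed

lemma ior_UN: "ior B X Y = (\<Union>x\<in>X. \<Union>y\<in>Y. {ba_join B x y})"
  by (auto simp: ior_def)

lemma iand_UN: "iand B X Y = (\<Union>x\<in>X. \<Union>y\<in>Y. {ba_meet B x y})"
  by (auto simp: iand_def)

theorem ltp_entails_imp_entails_in:
  fixes B :: "'b balg"
  assumes ent: "ltp_entails TYPE('u::infinite) \<Delta> \<psi>" and B: "boolalg B"
  shows "ltp_entails_in B \<Delta> \<psi>"
  unfolding ltp_entails_in_def
proof (intro allI impI subsetI)
  fix H a
  assume H: "ltp_hom B H" and aH: "a \<in> ba_carrier B \<inter> (\<Inter>\<phi>\<in>\<Delta>. H \<phi>)"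
  interpret boolalg B by (rule B)
  from aH have aC: "a \<in> ba_carrier B" by simp
  obtain S where S: "countable S" "S \<subseteq> ba_carrier B" "a \<in> S" "ba_zero B \<in> S" "ba_one B \<in> S"
    and S_compl: "\<And>x. x \<in> S \<Longrightarrow> ba_compl B x \<in> S"
    and S_join: "\<And>x y. x \<in> S \<Longrightarrow> y \<in> S \<Longrightarrow> ba_join B x y \<in> S"
    and S_meet: "\<And>x y. x \<in> S \<Longrightarrow> y \<in> S \<Longrightarrow> ba_meet B x y \<in> S"
    and S_or: "\<And>x \<phi> \<chi>. x \<in> S \<Longrightarrow> x \<in> H (IOr \<phi> \<chi>) \<Longrightarrow>
       \<exists>y\<in>S \<inter> H \<phi>. \<exists>z\<in>S \<inter> H \<chi>. x = ba_join B y z"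
    and S_and: "\<And>x \<phi> \<chi>. x \<in> S \<Longrightarrow> x \<in> H (IAnd \<phi> \<chi>) \<Longrightarrow>
       \<exists>y\<in>S \<inter> H \<phi>. \<exists>z\<in>S \<inter> H \<chi>. x = ba_meet B y z"
  proof (rule countable_witness_subalgebra[OF B H aC], goal_cases)
    case (1 S)
    show ?case by (rule 1(1)[OF 1(2-)])
  qed
  obtain g :: "nat \<Rightarrow> 'u" where g: "inj g"
    using infinite_countable_subset[OF infinite_UNIV] by blast
  define e where "e = g \<circ> to_nat_on S"
  have e: "inj_on e S"
    unfolding e_def using g S(1) by (auto intro!: comp_inj_on intro: inj_on_subset)
  define d where "d = inv_into S e"
  have de [simp]: "d (e x) = x" if "x \<in> S" for x
    unfolding d_def using e that by (rule inv_into_f_f)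
  define C where "C = \<lparr>ba_carrier = e ` S, ba_zero = e (ba_zero B), ba_one = e (ba_one B),
    ba_compl = (\<lambda>x. e (ba_compl B (d x))),
    ba_join = (\<lambda>x y. e (ba_join B (d x) (d y))),
    ba_meet = (\<lambda>x y. e (ba_meet B (d x) (d y)))\<rparr>"
  have SC: "x \<in> ba_carrier B" if "x \<in> S" for x using that S(2) by blast
  have C: "boolalg C"
    unfolding C_def
    by (unfold_locales; (simp only: balg.simps)?; (elim imageE)?; simp add: S S_compl S_join S_meet;
        rule arg_cong[of _ _ e];
        rule join_assoc meet_assoc join_commute meet_commute meet_join_distrib join_meet_distrib
          meet_one join_zero meet_compl join_compl;
        rule SC; assumption)
  have ior_image: "e ` ior B X Y = ior C (e ` X) (e ` Y)"
    and iand_image: "e ` iand B X Y = iand C (e ` X) (e ` Y)"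
    if "X \<subseteq> S" "Y \<subseteq> S" for X Y
  proof -
    have X: "d (e x) = x" if "x \<in> X" for x using that \<open>X \<subseteq> S\<close> by auto
    have Y: "d (e y) = y" if "y \<in> Y" for y using that \<open>Y \<subseteq> S\<close> by auto
    show "e ` ior B X Y = ior C (e ` X) (e ` Y)"
      by (simp add: ior_UN image_UN C_def X Y)
    show "e ` iand B X Y = iand C (e ` X) (e ` Y)"
      by (simp add: iand_UN image_UN C_def X Y)
  qed
  have ineg_image: "e ` ineg B X = ineg C (e ` X)" if "X \<subseteq> S" for X
  proof -
    have X: "d (e x) = x" if "x \<in> X" for x using that \<open>X \<subseteq> S\<close> by auto
    show ?thesis by (simp add: ineg_def Setcompr_eq_image image_image C_def X)
  qed
  define G where "G \<phi> = e ` (S \<inter> H \<phi>)" for \<phi>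
  have HB: "H Bot = {}" "H IBot = {ba_zero B}" "\<And>\<phi>. H (Neg \<phi>) = ba_carrier B - H \<phi>"
    "\<And>\<phi>. H (INeg \<phi>) = ineg B (H \<phi>)"
    "\<And>\<phi> \<chi>. H (Or \<phi> \<chi>) = H \<phi> \<union> H \<chi>" "\<And>\<phi> \<chi>. H (And \<phi> \<chi>) = H \<phi> \<inter> H \<chi>"
    "\<And>\<phi> \<chi>. H (IOr \<phi> \<chi>) = ior B (H \<phi>) (H \<chi>)"
    "\<And>\<phi> \<chi>. H (IAnd \<phi> \<chi>) = iand B (H \<phi>) (H \<chi>)"
    and HC: "\<And>\<phi>. H \<phi> \<subseteq> ba_carrier B"
    using H by (auto simp: ltp_hom_def)
  have dbl: "ba_compl B (ba_compl B x) = x" if x: "x \<in> ba_carrier B" for x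
  proof -
    let ?y = "ba_compl B x" let ?z = "ba_compl B ?y"
    have y: "?y \<in> ba_carrier B" and z: "?z \<in> ba_carrier B"
      using x by (auto intro: compl_closed)
    have "?z = ba_meet B ?z (ba_join B x ?y)" using x z by (simp add: join_compl meet_one)
    also have "\<dots> = ba_join B (ba_meet B ?z x) (ba_meet B ?z ?y)"
      using x y z by (simp add: meet_join_distrib)
    also have "ba_meet B ?z ?y = ba_meet B x ?y"
      using x y z by (simp add: meet_compl meet_commute[of ?z ?y])
    also have "ba_meet B ?z x = ba_meet B x ?z" using x z by (rule meet_commute[rotated])
    also have "ba_join B (ba_meet B x ?z) (ba_meet B x ?y) = ba_meet B x (ba_join B ?z ?y)"
      using x y z by (simp add: meet_join_distrib)
    also have "ba_join B ?z ?y = ba_one B"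
      using y z by (simp add: join_compl join_commute[of ?z ?y])
    finally show ?thesis using x by (simp add: meet_one)
  qed
  have G: "ltp_hom C G"
    unfolding ltp_hom_def
  proof (intro conjI allI)
    fix \<phi> \<chi>
    show "G \<phi> \<in> Pow (ba_carrier C)" by (auto simp: G_def C_def)
    show "G Bot = {}" by (simp add: G_def HB)
    show "G IBot = {ba_zero C}" using S by (auto simp: G_def HB C_def)
    show "G (Neg \<phi>) = ba_carrier C - G \<phi>"
    proof -
      have "S \<inter> H (Neg \<phi>) = S - (S \<inter> H \<phi>)" using S(2) by (auto simp: HB)
      then show ?thesis by (simp add: G_def C_def inj_on_image_set_diff[OF e])
    qed
    show "G (INeg \<phi>) = ineg C (G \<phi>)"
    proof -
      have "x \<in> ineg B (S \<inter> H \<phi>)" if x: "x \<in> S" "x \<in> H (INeg \<phi>)" for x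
      proof -
        obtain y where y: "y \<in> H \<phi>" "x = ba_compl B y" using x by (auto simp: HB ineg_def)
        then have "y = ba_compl B x" using dbl HC by (metis subsetD)
        then show ?thesis using y S_compl[OF x(1)] by (auto simp: ineg_def)
      qed
      then have "S \<inter> H (INeg \<phi>) = ineg B (S \<inter> H \<phi>)"
        using S_compl by (auto simp: HB ineg_def)
      then show ?thesis by (simp add: G_def ineg_image)
    qed
    show "G (Or \<phi> \<chi>) = G \<phi> \<union> G \<chi>" by (auto simp: G_def HB)
    show "G (And \<phi> \<chi>) = G \<phi> \<inter> G \<chi>"
      using e by (auto simp: G_def HB inj_on_def)
    show "G (IOr \<phi> \<chi>) = ior C (G \<phi>) (G \<chi>)"
    proof -
      have "S \<inter> H (IOr \<phi> \<chi>) = ior B (S \<inter> H \<phi>) (S \<inter> H \<chi>)"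
      proof
        show "S \<inter> H (IOr \<phi> \<chi>) \<subseteq> ior B (S \<inter> H \<phi>) (S \<inter> H \<chi>)"
          using S_or[of _ \<phi> \<chi>] unfolding ior_def by blast
        show "ior B (S \<inter> H \<phi>) (S \<inter> H \<chi>) \<subseteq> S \<inter> H (IOr \<phi> \<chi>)"
          using S_join unfolding ior_def HB by blast
      qed
      then show ?thesis by (simp add: G_def ior_image)
    qed
    show "G (IAnd \<phi> \<chi>) = iand C (G \<phi>) (G \<chi>)"
    proof -
      have "S \<inter> H (IAnd \<phi> \<chi>) = iand B (S \<inter> H \<phi>) (S \<inter> H \<chi>)"
      proof
        show "S \<inter> H (IAnd \<phi> \<chi>) \<subseteq> iand B (S \<inter> H \<phi>) (S \<inter> H \<chi>)"
          using S_and[of _ \<phi> \<chi>] unfolding iand_def by blast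
        show "iand B (S \<inter> H \<phi>) (S \<inter> H \<chi>) \<subseteq> S \<inter> H (IAnd \<phi> \<chi>)"
          using S_meet unfolding iand_def HB by blast
      qed
      then show ?thesis by (simp add: G_def iand_image)
    qed
  qed
  have "e a \<in> ba_carrier C \<inter> (\<Inter>\<phi>\<in>\<Delta>. G \<phi>)"
    using aH S(3) by (auto simp: C_def G_def)
  moreover have "ltp_entails_in C \<Delta> \<psi>" using ent C by (simp add: ltp_entails_def)
  ultimately have "e a \<in> G \<psi>" using G unfolding ltp_entails_in_def by blast
  then obtain b where b: "b \<in> S" "b \<in> H \<psi>" "e a = e b" by (auto simp: G_def)
  then show "a \<in> H \<psi>" using inj_onD[OF e b(3) S(3) b(1)] by simp
qed

corollary ltp_entails_universe_independent:
  "ltp_entails TYPE('u::infinite) \<Delta> \<psi> \<longleftrightarrow> ltp_entails TYPE('v::infinite) \<Delta> \<psi>"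
  using ltp_entails_imp_entails_in[where 'u='u and 'b='v]
    ltp_entails_imp_entails_in[where 'u='v and 'b='u]
  unfolding ltp_entails_def[where 'u='u] ltp_entails_def[where 'u='v]
  by (metis ltp_entails_def)


section \<open>Canonical Boolean algebras\<close>

text \<open>\<open>B\<close> may live on a type other than the universe \<open>'u\<close> of the consequence relation.\<close>

definition ltp_canonical :: "'u::infinite itself \<Rightarrow> 'b balg \<Rightarrow> bool" where
  "ltp_canonical U B \<longleftrightarrow>
     boolalg B \<and> (\<forall>\<Delta> \<psi>. ltp_entails U \<Delta> \<psi> \<longleftrightarrow> ltp_entails_in B \<Delta> \<psi>)"

end

theory Submission
  imports Defs
begin

text \<open>A nontrivial algebra satisfies the consequence of \<open>\<bottom>\<close> from the formula denoting
  \<open>{0} \<inter> {1}\<close>, which fails in the one-element algebra; the one-element algebra validates the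
  formula denoting \<open>{0}\<close>, which fails in the two-element algebra.\<close>

text \<open>The homomorphism on the free formula algebra extending the valuation \<open>v\<close>.
  It supplies concrete homomorphisms, without which an assumed entailment yields no
  information.\<close>

primrec ltp_eval :: "'a balg \<Rightarrow> (nat \<Rightarrow> 'a set) \<Rightarrow> ltp \<Rightarrow> 'a set" where
  "ltp_eval B v (Var n) = v n"
| "ltp_eval B v Bot = {}"
| "ltp_eval B v IBot = {ba_zero B}"
| "ltp_eval B v (Neg \<phi>) = ba_carrier B - ltp_eval B v \<phi>"
| "ltp_eval B v (INeg \<phi>) = ineg B (ltp_eval B v \<phi>)"
| "ltp_eval B v (Or \<phi> \<chi>) = ltp_eval B v \<phi> \<union> ltp_eval B v \<chi>"
| "ltp_eval B v (And \<phi> \<chi>) = ltp_eval B v \<phi> \<inter> ltp_eval B v \<chi>"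
| "ltp_eval B v (IOr \<phi> \<chi>) = ior B (ltp_eval B v \<phi>) (ltp_eval B v \<chi>)"
| "ltp_eval B v (IAnd \<phi> \<chi>) = iand B (ltp_eval B v \<phi>) (ltp_eval B v \<chi>)"

context boolalg
begin

lemma compl_zero: "ba_compl B (ba_zero B) = ba_one B"
  using join_compl[OF zero_closed] join_zero[OF compl_closed[OF zero_closed]]
    join_commute[OF zero_closed compl_closed[OF zero_closed]]
  by simp

lemma meet_zero:
  assumes x: "x \<in> ba_carrier B"
  shows "ba_meet B x (ba_zero B) = ba_zero B"
proof -
  have "ba_meet B x (ba_zero B) = ba_meet B x (ba_meet B x (ba_compl B x))"
    using x by (simp add: meet_compl)
  also have "\<dots> = ba_meet B (ba_meet B x x) (ba_compl B x)"
    using x by (simp add: meet_assoc compl_closed)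
  \<comment> \<open>Idempotence of meet is not among the axioms; it is derived here by adding
    \<open>0 = x * -x\<close> and factoring out \<open>x\<close>.\<close>
  also have "ba_meet B x x = ba_join B (ba_meet B x x) (ba_meet B x (ba_compl B x))"
    using x by (simp add: meet_compl join_zero meet_closed)
  also have "\<dots> = x"
    using x by (simp add: meet_join_distrib[symmetric] compl_closed join_compl meet_one)
  finally show ?thesis using x by (simp add: meet_compl)
qed

text \<open>Every element collapses: \<open>x = x * 1 = x * 0 = 0\<close>.\<close>

lemma carrier_trivial:
  assumes "ba_zero B = ba_one B"
  shows "ba_carrier B = {ba_zero B}"
proof -
  have "x = ba_zero B" if "x \<in> ba_carrier B" for x
    using meet_zero[OF that] meet_one[OF that] assms by simp
  then show ?thesis using zero_closed by blast
qed

lemma ltp_eval_subset: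
  assumes "\<And>n. v n \<subseteq> ba_carrier B"
  shows "ltp_eval B v \<phi> \<subseteq> ba_carrier B"
proof (induction \<phi>)
  case (Var n)
  then show ?case using assms by simp
next
  case (INeg \<phi>)
  then show ?case by (auto simp: ineg_def subset_iff intro: compl_closed)
next
  case (IOr \<phi> \<chi>)
  then show ?case by (auto simp: ior_def subset_iff intro: join_closed)
next
  case (IAnd \<phi> \<chi>)
  then show ?case by (auto simp: iand_def subset_iff intro: meet_closed)
qed (use zero_closed in auto)

lemma ltp_hom_eval:
  assumes "\<And>n. v n \<subseteq> ba_carrier B"
  shows "ltp_hom B (ltp_eval B v)"
  unfolding ltp_hom_def using ltp_eval_subset[OF assms] by simp

text \<open>Both formulas are variable-free, so every homomorphism gives them the same values. As
  \<open>-0 = 1\<close>, the premise is satisfiable exactly when 0 and 1 coincide.\<close>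

lemma entails_bot_iff_nontrivial:
  "ltp_entails_in B {And IBot (INeg IBot)} Bot \<longleftrightarrow> ba_zero B \<noteq> ba_one B"
proof
  assume ent: "ltp_entails_in B {And IBot (INeg IBot)} Bot"
  \<comment> \<open>Any valuation into the carrier would do, as no variable occurs; the empty one is
    plainly admissible.\<close>
  have "ltp_hom B (ltp_eval B (\<lambda>_. {}))" by (rule ltp_hom_eval) simp
  with ent have "ba_carrier B \<inter> (\<Inter>\<phi>\<in>{And IBot (INeg IBot)}. ltp_eval B (\<lambda>_. {}) \<phi>)
      \<subseteq> ltp_eval B (\<lambda>_. {}) Bot"
    unfolding ltp_entails_in_def by blast
  then have "ba_carrier B \<inter> ({ba_zero B} \<inter> {ba_one B}) \<subseteq> {}"
    by (simp add: ineg_def compl_zero)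
  then show "ba_zero B \<noteq> ba_one B" using zero_closed by auto
next
  assume "ba_zero B \<noteq> ba_one B"
  then show "ltp_entails_in B {And IBot (INeg IBot)} Bot"
    by (auto simp: ltp_entails_in_def ltp_hom_def ineg_def compl_zero)
qed

text \<open>With no premises the intersection is the whole carrier, so the entailment says that 0 is
  the only element.\<close>

lemma entails_ibot_iff_trivial:
  "ltp_entails_in B {} IBot \<longleftrightarrow> ba_zero B = ba_one B"
proof
  assume ent: "ltp_entails_in B {} IBot"
  have "ltp_hom B (ltp_eval B (\<lambda>_. {}))" by (rule ltp_hom_eval) simp
  with ent have "ba_carrier B \<subseteq> {ba_zero B}"
    unfolding ltp_entails_in_def by force
  then show "ba_zero B = ba_one B" using one_closed by auto
next
  assume "ba_zero B = ba_one B"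
  then have "ba_carrier B = {ba_zero B}" by (rule carrier_trivial)
  moreover have "H IBot = {ba_zero B}" if "ltp_hom B H" for H
    using that unfolding ltp_hom_def by (elim conjE)
  ultimately show "ltp_entails_in B {} IBot"
    by (simp add: ltp_entails_in_def)
qed

end

theorem theorem3p11:
  shows "\<not> (\<exists>B :: 'b balg. ltp_canonical TYPE('u::infinite) B)"
proof
  assume "\<exists>B :: 'b balg. ltp_canonical TYPE('u) B"
  then obtain B :: "'b balg" where B: "boolalg B"
    and ent: "\<And>\<Delta> \<psi>. ltp_entails_in B \<Delta> \<psi> \<Longrightarrow> ltp_entails TYPE('u) \<Delta> \<psi>"
    by (auto simp: ltp_canonical_def)
  show False
  proof (cases "ba_zero B = ba_one B")
    case True
    then have "ltp_entails TYPE('u) {} IBot"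
      using boolalg.entails_ibot_iff_trivial[OF B] ent by blast
    \<comment> \<open>\<open>bool\<close> is a finite type and so cannot itself be the universe
      \<open>'u\<close>; consequence is transferred to this two-element algebra, where 0 and 1
      differ.\<close>
    from ltp_entails_imp_entails_in[OF this boolalg_type_class[where 'a = bool]]
    show False
      unfolding boolalg.entails_ibot_iff_trivial[OF boolalg_type_class] by simp
  next
    case False
    then have "ltp_entails TYPE('u) {And IBot (INeg IBot)} Bot"
      using boolalg.entails_bot_iff_nontrivial[OF B] ent by blast
    \<comment> \<open>Likewise for \<open>unit\<close>, the one-element algebra, where 0 and 1
      coincide.\<close>
    from ltp_entails_imp_entails_in[OF this boolalg_type_class[where 'a = unit]]
    show False
      unfolding boolalg.entails_bot_iff_nontrivial[OF boolalg_type_class] by simp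
  qed
qed

end
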